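(* Let $f$ be meromorphic on $\mathbb{C}$ with divisor $D=((a_n),(b_n))$. Suppose that for every $\delta>0$ there is $C_\delta$ with $1/C_\delta\le|f(z)|\le C_\delta$ for all $z\notin A(\delta)$, that $\inf_{n,k}|a_n-b_k|>0$, and that there is $C_0$ with ${\rm card}\{n:|a_n-c|\le1\}+{\rm card}\{n:|b_n-c|\le1\}<C_0$ for all $c\in\mathbb{C}$. Then $f$ is a normal function.
   Context: $\rho_S$ is the spherical metric. A meromorphic $f$ on $\mathbb{C}$ is normal if every sequence $(h_n)\subset\mathbb{C}$ has a subsequence $(h_{n'})$ with $\rho_S(f(z+h_{n'}),f(z+h_{m'}))\to0$ as $n',m'\to\infty$ uniformly on compact subsets of $\mathbb{C}$. The divisor lists zeros $a_n$ and poles $b_n$ with multiplicity. $A(\delta)=\bigcup_nB(a_n,\delta)\cup\bigcup_nB(b_n,\delta)$. *)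

theory Defs
  imports "HOL-Analysis.Analysis"
begin

text \<open>Local normal form of a meromorphic function (not identically zero) at z0:
  near z0, f z = (z - z0) powi m * g z with g holomorphic and zero-free.
  At z0 itself the identity is required only when m \<ge> 0 (the value at a pole is irrelevant).\<close>
definition mero_at :: "(complex \<Rightarrow> complex) \<Rightarrow> complex \<Rightarrow> int \<Rightarrow> bool" where
  "mero_at f z0 m \<longleftrightarrow> (\<exists>r>0. \<exists>g. g holomorphic_on ball z0 r \<and> (\<forall>z\<in>ball z0 r. g z \<noteq> 0) \<and>
      (\<forall>z\<in>ball z0 r. (z \<noteq> z0 \<or> m \<ge> 0) \<longrightarrow> f z = (z - z0) powi m * g z))"

text \<open>f is meromorphic on the whole plane (and not identically zero, so it has a divisor).\<close>
definition meromorphic_C :: "(complex \<Rightarrow> complex) \<Rightarrow> bool" where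
  "meromorphic_C f \<longleftrightarrow> (\<forall>z0. \<exists>m. mero_at f z0 m)"

definition mord :: "(complex \<Rightarrow> complex) \<Rightarrow> complex \<Rightarrow> int" where
  "mord f z0 = (THE m. mero_at f z0 m)"

text \<open>Value in the Riemann sphere; None represents \<infinity>.\<close>
definition ext_val :: "(complex \<Rightarrow> complex) \<Rightarrow> complex \<Rightarrow> complex option" where
  "ext_val f z = (if mord f z < 0 then None else Some (f z))"

fun rho_S :: "complex option \<Rightarrow> complex option \<Rightarrow> real" where
  "rho_S (Some z) (Some w) = 2 * cmod (z - w) / sqrt ((1 + (cmod z)\<^sup>2) * (1 + (cmod w)\<^sup>2))"
| "rho_S (Some z) None = 2 / sqrt (1 + (cmod z)\<^sup>2)"
| "rho_S None (Some w) = 2 / sqrt (1 + (cmod w)\<^sup>2)"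
| "rho_S None None = 0"

definition is_normal_function :: "(complex \<Rightarrow> complex) \<Rightarrow> bool" where
  "is_normal_function f \<longleftrightarrow> (\<forall>h :: nat \<Rightarrow> complex. \<exists>s :: nat \<Rightarrow> nat. strict_mono s \<and>
     (\<forall>K. compact K \<longrightarrow> (\<forall>e>0. \<exists>N. \<forall>n\<ge>N. \<forall>m\<ge>N. \<forall>z\<in>K.
        rho_S (ext_val f (z + h (s n))) (ext_val f (z + h (s m))) < e)))"

definition Adelta :: "(complex \<Rightarrow> complex) \<Rightarrow> real \<Rightarrow> complex set" where
  "Adelta f \<delta> = (\<Union>a\<in>{a. mord f a \<noteq> 0}. ball a \<delta>)"

end

(* Every disc of radius e small compared with the distance between zeros and poles is free of poles
   or free of zeros. Since the divisor has boundedly many points in the disc, a concentric circle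
   stays at a fixed distance from it, so there |f| <= C and |1/f| <= C. By the maximum principle and
   Cauchy's inequality, f (or 1/f if there are poles) is Lipschitz on a smaller disc with a constant
   independent of the centre. As inversion is an isometry of the sphere, the translates of f are
   equicontinuous for rho_S; stereographic projection and Arzela-Ascoli give normality. *)
theory Submission
  imports Defs "HOL-Complex_Analysis.Complex_Analysis"
begin

section \<open>Uniqueness of the order and isolation of zeros and poles\<close>

lemma mero_at_eventually:
  assumes "mero_at f z0 m"
  obtains g where "isCont g z0" "g z0 \<noteq> 0" "\<forall>\<^sub>F z in at z0. f z = (z - z0) powi m * g z"
proof -
  obtain r g where r: "r > 0" and g: "g holomorphic_on ball z0 r" "\<forall>z\<in>ball z0 r. g z \<noteq> 0"
    and f: "\<forall>z\<in>ball z0 r. (z \<noteq> z0 \<or> m \<ge> 0) \<longrightarrow> f z = (z - z0) powi m * g z"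
    using assms unfolding mero_at_def by blast
  show thesis
  proof
    show "isCont g z0"
      using g(1) r by (meson centre_in_ball continuous_on_eq_continuous_at holomorphic_on_imp_continuous_on open_ball)
    show "g z0 \<noteq> 0" using g(2) r by simp
    show "\<forall>\<^sub>F z in at z0. f z = (z - z0) powi m * g z"
      unfolding eventually_at using r f by (intro exI[of _ r]) (auto simp: dist_commute)
  qed
qed

text \<open>If \<open>n > m\<close>, cancelling \<open>(z - z0) powi m\<close> from the two normal
  forms leaves \<open>g\<close> equal near \<open>z0\<close> to a positive power of
  \<open>z - z0\<close> times \<open>h\<close>. This tends to 0, against
  \<open>g z0 \<noteq> 0\<close>. Applied both ways, it makes the order unique, so the description
  operator in \<open>mord\<close> is meaningful.\<close>

lemma mero_at_le:
  assumes "mero_at f z0 m" "mero_at f z0 n"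
  shows "n \<le> m"
proof (rule ccontr)
  assume "\<not> n \<le> m"
  then have mn: "n - m > 0" by simp
  obtain g where g: "isCont g z0" "g z0 \<noteq> 0" "\<forall>\<^sub>F z in at z0. f z = (z - z0) powi m * g z"
    using mero_at_eventually[OF assms(1)] .
  obtain h where h: "isCont h z0" "\<forall>\<^sub>F z in at z0. f z = (z - z0) powi n * h z"
    using mero_at_eventually[OF assms(2)] by metis
  have "\<forall>\<^sub>F z in at z0. (z - z0) ^ nat (n - m) * h z = g z"
    using g(3) h(2) eventually_neq_at_within[of z0 z0 UNIV]
  proof eventually_elim
    case (elim z)
    have "(z - z0) powi n = (z - z0) powi m * (z - z0) powi (n - m)"
      using elim(3) by (simp flip: power_int_add)
    also have "(z - z0) powi (n - m) = (z - z0) ^ nat (n - m)"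
      using mn by (simp add: power_int_def)
    finally show ?case using elim by simp
  qed
  moreover have "((\<lambda>z. (z - z0) ^ nat (n - m) * h z) \<longlongrightarrow> (z0 - z0) ^ nat (n - m) * h z0) (at z0)"
    using h(1) by (intro tendsto_intros) (simp add: isCont_def)
  ultimately have "(g \<longlongrightarrow> (z0 - z0) ^ nat (n - m) * h z0) (at z0)"
    by (rule Lim_transform_eventually[rotated])
  moreover have "(g \<longlongrightarrow> g z0) (at z0)" using g(1) by (simp add: isCont_def)
  ultimately have "g z0 = (z0 - z0) ^ nat (n - m) * h z0"
    by (metis LIM_unique)
  with g(2) mn show False by simp
qed

lemma mord_eqI: "mero_at f z0 m \<Longrightarrow> mord f z0 = m"
  unfolding mord_def by (rule the_equality) (auto intro: antisym mero_at_le)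

lemma mero_at_mord: "meromorphic_C f \<Longrightarrow> mero_at f z0 (mord f z0)"
  using mord_eqI meromorphic_C_def by metis

lemma mero_at_0I:
  assumes "open S" "z \<in> S" "f holomorphic_on S" "\<And>w. w \<in> S \<Longrightarrow> f w \<noteq> 0"
  shows "mero_at f z 0"
proof -
  obtain r where "r > 0" "ball z r \<subseteq> S" using assms(1,2) open_contains_ball by blast
  with assms show ?thesis
    unfolding mero_at_def
    by (intro exI[of _ r] conjI exI[of _ f]) (auto intro: holomorphic_on_subset)
qed

text \<open>Away from the centre both factors of the normal form are holomorphic and zero-free, so
  zeros and poles are isolated. This matters for \<open>reciprocal\<close>, whose value at each
  point depends on the order there.\<close>

lemma mero_at_punctured:
  assumes "mero_at f z0 m"
  obtains r g where "r > 0" "g holomorphic_on ball z0 r" "\<And>z. z \<in> ball z0 r \<Longrightarrow> g z \<noteq> 0"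
    "\<And>z. z \<in> ball z0 r \<Longrightarrow> z \<noteq> z0 \<or> m \<ge> 0 \<Longrightarrow> f z = (z - z0) powi m * g z"
    "\<And>z. z \<in> ball z0 r \<Longrightarrow> z \<noteq> z0 \<Longrightarrow> mord f z = 0"
proof -
  obtain r g where r: "r > 0" and g: "g holomorphic_on ball z0 r" "\<forall>z\<in>ball z0 r. g z \<noteq> 0"
    and f: "\<forall>z\<in>ball z0 r. (z \<noteq> z0 \<or> m \<ge> 0) \<longrightarrow> f z = (z - z0) powi m * g z"
    using assms unfolding mero_at_def by blast
  have "mero_at f z 0" if "z \<in> ball z0 r" "z \<noteq> z0" for z
  proof (rule mero_at_0I)
    show "open (ball z0 r - {z0})" by (simp add: open_delete)
    show "z \<in> ball z0 r - {z0}" using that by simp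
    have "(\<lambda>z. (z - z0) powi m * g z) holomorphic_on ball z0 r - {z0}"
      using g(1) by (intro holomorphic_intros) (auto elim: holomorphic_on_subset)
    then show "f holomorphic_on ball z0 r - {z0}"
      by (rule holomorphic_transform) (use f in auto)
    show "f w \<noteq> 0" if "w \<in> ball z0 r - {z0}" for w
      using f g(2) that by auto
  qed
  with r g f show thesis by (intro that[of r g]) (auto simp: mord_eqI)
qed

text \<open>For a nonnegative order the normal form also holds at the centre, and its integer power
  is an ordinary power, hence holomorphic there.\<close>

lemma field_differentiable_if_mord_nonneg:
  assumes "meromorphic_C f" "mord f z0 \<ge> 0"
  shows "f field_differentiable at z0"
proof -
  obtain r g where r: "r > 0" "g holomorphic_on ball z0 r"
    and f: "\<And>z. z \<in> ball z0 r \<Longrightarrow> z \<noteq> z0 \<or> mord f z0 \<ge> 0 \<Longrightarrow> f z = (z - z0) powi mord f z0 * g z"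
    using mero_at_punctured[OF mero_at_mord[OF assms(1), of z0]] by metis
  have "(\<lambda>z. (z - z0) ^ nat (mord f z0) * g z) holomorphic_on ball z0 r"
    using r by (intro holomorphic_intros)
  then have "f holomorphic_on ball z0 r"
    by (rule holomorphic_transform) (use f assms(2) in \<open>auto simp: power_int_def\<close>)
  with r(1) show ?thesis
    by (meson centre_in_ball holomorphic_on_imp_differentiable_at open_ball)
qed

lemma nonzero_if_mord_eq_0:
  assumes "meromorphic_C f" "mord f z = 0"
  shows "f z \<noteq> 0"
  using mero_at_mord[OF assms(1), of z] assms(2) unfolding mero_at_def
  by (metis centre_in_ball mult_1 order_refl power_int_0_right)

section \<open>The reciprocal as a meromorphic function\<close>

text \<open>The value of \<open>f\<close> at a pole is arbitrary, so the value 0 is imposed there.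
  At a zero of \<open>f\<close> the default \<open>inverse 0 = 0\<close> is harmless: it is a pole
  of the reciprocal, where \<open>mero_at\<close> prescribes no value.\<close>

definition reciprocal :: "(complex \<Rightarrow> complex) \<Rightarrow> complex \<Rightarrow> complex" where
  "reciprocal f z = (if mord f z < 0 then 0 else inverse (f z))"

lemma mero_at_reciprocal:
  assumes "meromorphic_C f"
  shows "mero_at (reciprocal f) z0 (- mord f z0)"
proof -
  define m where "m = mord f z0"
  obtain r g where r: "r > 0" and g: "g holomorphic_on ball z0 r" "\<And>z. z \<in> ball z0 r \<Longrightarrow> g z \<noteq> 0"
    and f: "\<And>z. z \<in> ball z0 r \<Longrightarrow> z \<noteq> z0 \<or> m \<ge> 0 \<Longrightarrow> f z = (z - z0) powi m * g z"
    and m0: "\<And>z. z \<in> ball z0 r \<Longrightarrow> z \<noteq> z0 \<Longrightarrow> mord f z = 0"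
    using mero_at_punctured[OF mero_at_mord[OF assms, of z0]] unfolding m_def by metis
  have "reciprocal f z = (z - z0) powi (- m) * inverse (g z)"
    if z: "z \<in> ball z0 r" "z \<noteq> z0 \<or> - m \<ge> 0" for z
  proof (cases "z = z0")
    case True
    \<comment> \<open>Here \<open>m \<le> 0\<close>. For \<open>m < 0\<close> both sides are 0 at
      the pole; for \<open>m = 0\<close> the power is 1 and \<open>f z0 = g z0\<close>.\<close>
    with z r f[of z0] show ?thesis
      by (auto simp: reciprocal_def m_def power_int_0_left_if)
  next
    case False
    with z f[of z] m0[of z] show ?thesis
      by (simp add: reciprocal_def power_int_minus)
  qed
  moreover have "(\<lambda>z. inverse (g z)) holomorphic_on ball z0 r"
    using g by (intro holomorphic_intros) auto
  ultimately show ?thesis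
    using r g unfolding mero_at_def m_def[symmetric]
    by (intro exI[of _ r] conjI exI[of _ "\<lambda>z. inverse (g z)"]) auto
qed

lemma mord_reciprocal: "meromorphic_C f \<Longrightarrow> mord (reciprocal f) z = - mord f z"
  by (intro mord_eqI mero_at_reciprocal)

lemma meromorphic_C_reciprocal: "meromorphic_C f \<Longrightarrow> meromorphic_C (reciprocal f)"
  unfolding meromorphic_C_def[of "reciprocal f"] using mero_at_reciprocal by blast

section \<open>Circles avoiding the divisor and a Lipschitz estimate\<close>

text \<open>Pigeonhole: the \<open>N + 1\<close> candidates \<open>u + 2 \<delta> j\<close> are \<open>2 \<delta>\<close> apart, so each point of \<open>D\<close> excludes
  at most one of them.\<close>
lemma exists_distant_point:
  fixes D :: "real set" and u \<delta> :: real
  assumes "finite D" "card D \<le> N" "\<delta> > 0"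
  obtains t where "u \<le> t" "t \<le> u + 2 * \<delta> * N" "\<And>d. d \<in> D \<Longrightarrow> \<delta> \<le> \<bar>d - t\<bar>"
proof -
  have "\<exists>j\<le>N. \<forall>d\<in>D. \<delta> \<le> \<bar>d - (u + 2 * \<delta> * real j)\<bar>"
  proof (rule ccontr)
    assume "\<not> ?thesis"
    then obtain p where p: "\<And>j. j \<le> N \<Longrightarrow> p j \<in> D \<and> \<bar>p j - (u + 2 * \<delta> * real j)\<bar> < \<delta>"
      by (metis not_le)
    have less: "p i < p j" if "i < j" "j \<le> N" for i j
    proof -
      have "2 * \<delta> * real i + 2 * \<delta> \<le> 2 * \<delta> * real j"
        using mult_left_mono[of "real i + 1" "real j" "2 * \<delta>"] that assms(3)
        by (simp add: algebra_simps)
      with p[of i] p[of j] that show ?thesis by linarith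
    qed
    have "inj_on p {..N}"
      using less by (intro linorder_inj_onI) (auto simp: less_le)
    moreover have "p ` {..N} \<subseteq> D" using p by auto
    ultimately have "card {..N} \<le> card D" using assms(1) card_inj_on_le by blast
    with assms(2) show False by simp
  qed
  then obtain j where j: "j \<le> N" "\<forall>d\<in>D. \<delta> \<le> \<bar>d - (u + 2 * \<delta> * real j)\<bar>" by blast
  show thesis
    by (rule that[of "u + 2 * \<delta> * real j"]) (use j assms(3) in auto)
qed

text \<open>At most \<open>N\<close> distances to \<open>c\<close> have to be avoided by the radius,
  and the reverse triangle inequality turns a gap between radii into a gap between points. Points of
  \<open>A\<close> farther than 1 from \<open>c\<close> are at least 1/2 away from the circle, since
  \<open>t < e \<le> 1/2\<close>.\<close>

lemma exists_distant_circle: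
  fixes c :: complex
  assumes "0 < e" "e \<le> 1/2"
    and fin: "finite {a\<in>A. dist a c \<le> 1}" and card: "card {a\<in>A. dist a c \<le> 1} \<le> N"
  obtains t where "e/2 \<le> t" "t < e" "\<And>a z. a \<in> A \<Longrightarrow> dist c z = t \<Longrightarrow> e / (4 * (real N + 1)) \<le> dist a z"
proof -
  define \<delta> where "\<delta> = e / (4 * (real N + 1))"
  have \<delta>: "\<delta> > 0" using assms(1) by (simp add: \<delta>_def)
  \<comment> \<open>This choice makes the largest candidate radius
    \<open>e/2 + 2 * \<delta> * N\<close> equal to \<open>e - 2 * \<delta>\<close>, still below
    \<open>e\<close>.\<close>
  have \<delta>N: "4 * \<delta> * N + 4 * \<delta> = e" by (simp add: \<delta>_def divide_simps) (simp add: algebra_simps)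
  define D where "D = (\<lambda>a. dist a c) ` {a\<in>A. dist a c \<le> 1}"
  have "finite D" "card D \<le> N"
    using fin card card_image_le[OF fin, of "\<lambda>a. dist a c"] by (auto simp: D_def)
  then obtain t where t: "e/2 \<le> t" "t \<le> e/2 + 2 * \<delta> * N" "\<And>d. d \<in> D \<Longrightarrow> \<delta> \<le> \<bar>d - t\<bar>"
    using exists_distant_point \<delta> by metis
  have "0 \<le> \<delta> * N" using \<delta> by simp
  then have te: "t < e" "\<delta> \<le> 1/2" using t \<delta>N \<delta> assms(2) by auto
  have "\<delta> \<le> dist a z" if "a \<in> A" "dist c z = t" for a z
  proof (cases "dist a c \<le> 1")
    case True
    then have "\<delta> \<le> \<bar>dist a c - t\<bar>" using t(3) that(1) by (auto simp: D_def)
    also have "\<dots> \<le> dist a z" 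
      using that(2) dist_triangle[of a c z] dist_triangle[of c z a]
      by (auto simp: dist_commute abs_le_iff)
    finally show ?thesis .
  next
    case False
    then show ?thesis using that(2) dist_triangle[of a c z] te assms(2) by (simp add: dist_commute)
  qed
  with t te show thesis by (intro that[of t]) (auto simp: \<delta>_def)
qed

text \<open>The bound holds on a circle avoiding \<open>A\<close>, and the maximum principle carries
  it to the enclosed disc, including points of \<open>A\<close>. Cauchy's inequality on discs of
  radius \<open>e/8\<close> then bounds the derivative on the smaller disc.\<close>

lemma lipschitz_if_bounded_off_sparse_set:
  fixes f :: "complex \<Rightarrow> complex"
  assumes hol: "f holomorphic_on ball c e" and e: "0 < e" "e \<le> 1/2"
    and fin: "finite {a\<in>A. dist a c \<le> 1}" and card: "card {a\<in>A. dist a c \<le> 1} \<le> N"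
    and bnd: "\<And>z. (\<And>a. a \<in> A \<Longrightarrow> e / (4 * (real N + 1)) \<le> dist a z) \<Longrightarrow> cmod (f z) \<le> C"
    and xy: "x \<in> ball c (e/4)" "y \<in> ball c (e/4)"
  shows "cmod (f x - f y) \<le> 8 * C / e * cmod (x - y)"
proof -
  obtain t where t: "e/2 \<le> t" "t < e"
    "\<And>a z. a \<in> A \<Longrightarrow> dist c z = t \<Longrightarrow> e / (4 * (real N + 1)) \<le> dist a z"
    using exists_distant_circle[OF e fin card] by metis
  have sub: "cball c t \<subseteq> ball c e" using t(2) by auto
  have max: "cmod (f z) \<le> C" if "z \<in> cball c t" for z
  proof (rule maximum_modulus_frontier[of f "cball c t"])
    show "f holomorphic_on interior (cball c t)"
      using hol sub by (meson holomorphic_on_subset interior_subset subset_trans)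
    show "continuous_on (closure (cball c t)) f"
      using continuous_on_subset[OF holomorphic_on_imp_continuous_on[OF hol] sub] by simp
    show "cmod (f w) \<le> C" if "w \<in> frontier (cball c t)" for w
      using that t e by (intro bnd t(3)) auto
  qed (use that in auto)
  show ?thesis
  proof (rule field_differentiable_bound[of "ball c (e/4)" f "deriv f"])
    fix z assume z: "z \<in> ball c (e/4)"
    then have "z \<in> ball c e" using e by auto
    with hol show "(f has_field_derivative deriv f z) (at z within ball c (e/4))"
      by (metis holomorphic_derivI open_ball has_field_derivative_at_within)
    \<comment> \<open>The margin suffices because \<open>e/4 + e/8 < e/2 \<le> t\<close>.\<close>
    have sub': "cball z (e/8) \<subseteq> cball c t"
    proof
      fix w assume "w \<in> cball z (e/8)"
      then show "w \<in> cball c t" using z t(1) e(1) dist_triangle[of c w z] by auto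
    qed
    have "cmod ((deriv ^^ 1) f z) \<le> fact 1 * C / (e/8) ^ 1"
    proof (rule Cauchy_inequality)
      show "f holomorphic_on ball z (e/8)"
        using hol sub sub' ball_subset_cball by (meson holomorphic_on_subset subset_trans)
      show "continuous_on (cball z (e/8)) f"
        using hol sub sub' by (meson continuous_on_subset holomorphic_on_imp_continuous_on subset_trans)
      show "cmod (f w) \<le> C" if "cmod (z - w) = e/8" for w
        using that sub' by (intro max) (auto simp: dist_norm)
    qed (use e in simp)
    then show "cmod (deriv f z) \<le> 8 * C / e" by (simp add: mult.commute)
  qed (use xy in auto)
qed

section \<open>The chordal metric through stereographic projection\<close>

text \<open>The norm of \<open>complex \<times> real\<close> is that of Euclidean 3-space; the image
  is its unit sphere, with infinity at the north pole.\<close>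

fun stereographic :: "complex option \<Rightarrow> complex \<times> real" where
  "stereographic (Some z) = (2 * z / (1 + (cmod z)\<^sup>2), ((cmod z)\<^sup>2 - 1) / (1 + (cmod z)\<^sup>2))"
| "stereographic None = (0, 1)"

lemma norm_Pair_complex_real: "norm (z :: complex, t :: real) = sqrt ((Re z)\<^sup>2 + (Im z)\<^sup>2 + t\<^sup>2)"
  by (simp add: norm_Pair cmod_power2)

lemma chordal_identity:
  fixes a b c d :: real
  defines "p \<equiv> 1 + (a\<^sup>2 + b\<^sup>2)" and "q \<equiv> 1 + (c\<^sup>2 + d\<^sup>2)"
  shows "(2 * a / p - 2 * c / q)\<^sup>2 + (2 * b / p - 2 * d / q)\<^sup>2 + ((p - 2) / p - (q - 2) / q)\<^sup>2
    = 4 * ((a - c)\<^sup>2 + (b - d)\<^sup>2) / (p * q)"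
proof -
  have pos: "p > 0" "q > 0" by (simp_all add: p_def q_def add_pos_nonneg)
  have a: "a\<^sup>2 = p - 1 - b\<^sup>2" and c: "c\<^sup>2 = q - 1 - d\<^sup>2" by (auto simp: p_def q_def)
  \<comment> \<open>The last square on the left is \<open>(2*p - 2*q)^2\<close>, which supplies the
    summands 1 in the three brackets on the right.\<close>
  have "(2*a*q - 2*c*p)\<^sup>2 + (2*b*q - 2*d*p)\<^sup>2 + ((p-2)*q - (q-2)*p)\<^sup>2
    = 4 * (q\<^sup>2 * (a\<^sup>2 + b\<^sup>2 + 1) + p\<^sup>2 * (c\<^sup>2 + d\<^sup>2 + 1) - 2 * p * q * (a*c + b*d + 1))"
    by (simp add: power2_eq_square algebra_simps)
  also have "\<dots> = 4 * (q\<^sup>2 * p + p\<^sup>2 * q - 2 * p * q * (a*c + b*d + 1))"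
    by (simp add: a c)
  also have "\<dots> = 4 * (p * q) * (p + q - 2 * (a*c + b*d + 1))"
    by (simp add: power2_eq_square algebra_simps)
  also have "p + q - 2 * (a*c + b*d + 1) = (a - c)\<^sup>2 + (b - d)\<^sup>2"
    by (simp add: p_def q_def power2_eq_square algebra_simps)
  finally have *: "(2*a*q - 2*c*p)\<^sup>2 + (2*b*q - 2*d*p)\<^sup>2 + ((p-2)*q - (q-2)*p)\<^sup>2
    = 4 * (p * q) * ((a - c)\<^sup>2 + (b - d)\<^sup>2)" .
  have "(2 * a / p - 2 * c / q)\<^sup>2 + (2 * b / p - 2 * d / q)\<^sup>2 + ((p - 2) / p - (q - 2) / q)\<^sup>2
    = ((2*a*q - 2*c*p)\<^sup>2 + (2*b*q - 2*d*p)\<^sup>2 + ((p-2)*q - (q-2)*p)\<^sup>2) / (p * q)\<^sup>2"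
    using pos by (simp add: diff_frac_eq power_divide add_divide_distrib mult.commute)
  also have "\<dots> = 4 * ((a - c)\<^sup>2 + (b - d)\<^sup>2) / (p * q)"
    unfolding * using pos by (simp add: power2_eq_square)
  finally show ?thesis .
qed

text \<open>This makes \<open>rho_S\<close> the pullback of a norm distance, so the triangle
  inequality and Arzela-Ascoli become available. The third coordinate is written
  \<open>(p - 2) / p\<close> with \<open>p = 1 + |z|^2\<close> to fit
  \<open>chordal_identity\<close>.\<close>

lemma dist_stereographic: "dist (stereographic u) (stereographic v) = rho_S u v"
proof -
  have none: "dist (stereographic (Some z)) (0, 1) = 2 / sqrt (1 + (cmod z)\<^sup>2)" for z
  proof -
    define p where "p = 1 + (cmod z)\<^sup>2"
    have p: "p > 0" "(Re z)\<^sup>2 + (Im z)\<^sup>2 = p - 1" by (simp_all add: p_def add_pos_nonneg cmod_power2)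
    have "dist (stereographic (Some z)) (0, 1)
      = sqrt ((2 * Re z / p)\<^sup>2 + (2 * Im z / p)\<^sup>2 + ((p - 2) / p - 1)\<^sup>2)"
      by (simp add: dist_norm norm_Pair_complex_real p_def)
    also have "(2 * Re z / p)\<^sup>2 + (2 * Im z / p)\<^sup>2 + ((p - 2) / p - 1)\<^sup>2
      = (4 * ((Re z)\<^sup>2 + (Im z)\<^sup>2) + 4) / p\<^sup>2"
      using p(1) by (simp add: divide_simps power2_eq_square algebra_simps)
    also have "\<dots> = 4 / p" unfolding p(2) using p(1) by (simp add: power2_eq_square)
    finally show ?thesis by (simp add: p_def real_sqrt_divide)
  qed
  show ?thesis
  proof (cases u; cases v)
    fix z w assume uv: "u = Some z" "v = Some w"
    let ?p = "1 + (cmod z)\<^sup>2" and ?q = "1 + (cmod w)\<^sup>2"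
    have "dist (stereographic u) (stereographic v) =
      sqrt ((2 * Re z / ?p - 2 * Re w / ?q)\<^sup>2 + (2 * Im z / ?p - 2 * Im w / ?q)\<^sup>2
        + ((?p - 2) / ?p - (?q - 2) / ?q)\<^sup>2)"
      by (simp add: uv dist_norm norm_Pair_complex_real)
    also have "\<dots> = sqrt (4 * (cmod (z - w))\<^sup>2 / (?p * ?q))"
      using chordal_identity[of "Re z" "Im z" "Re w" "Im w"] by (simp add: cmod_power2)
    also have "\<dots> = rho_S u v"
      by (simp add: uv real_sqrt_divide real_sqrt_mult)
    finally show ?thesis .
  next
    fix z assume "u = Some z" "v = None"
    then show ?thesis using none[of z] by simp
  next
    fix w assume "u = None" "v = Some w"
    then show ?thesis using none[of w] by (simp add: dist_commute)
  qed simp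
qed

lemma rho_S_Some_le: "rho_S (Some z) (Some w) \<le> 2 * cmod (z - w)"
proof -
  have "1 \<le> (1 + (cmod z)\<^sup>2) * (1 + (cmod w)\<^sup>2)"
    by (simp add: algebra_simps)
  then have "1 \<le> sqrt ((1 + (cmod z)\<^sup>2) * (1 + (cmod w)\<^sup>2))" by simp
  then show ?thesis 
    by (simp add: divide_le_eq mult_left_le mult_le_cancel_left1)
qed

definition sphere_inverse :: "complex option \<Rightarrow> complex option" where
  "sphere_inverse u = (case u of None \<Rightarrow> Some 0 | Some z \<Rightarrow> if z = 0 then None else Some (inverse z))"

text \<open>On the unit sphere inversion is the half-turn about the real axis, hence an isometry.
  The computation rests on \<open>|z|^2 / z = cnj z\<close>.\<close>

lemma stereographic_sphere_inverse:
  "stereographic (sphere_inverse u) = (cnj (fst (stereographic u)), - snd (stereographic u))"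
proof (cases u)
  case (Some z)
  show ?thesis
  proof (cases "z = 0")
    case False
    define Z where "Z = (cmod z)\<^sup>2"
    have Z: "Z > 0" using False by (simp add: Z_def)
    have W: "(cmod (inverse z))\<^sup>2 = 1 / Z"
      by (simp add: Z_def inverse_eq_divide norm_divide power_divide)
    have "inverse z * of_real Z = cnj z"
      using False by (simp add: Z_def complex_norm_square[symmetric] field_simps)
    \<comment> \<open>Numerator and denominator are multiplied by \<open>Z = |z|^2\<close>.\<close>
    moreover have "2 * inverse z / of_real (1 + 1 / Z) = 2 * (inverse z * of_real Z) / of_real (1 + Z)"
    proof -
      have "1 + 1 / Z = (1 + Z) / Z" using Z by (simp add: field_simps)
      then show ?thesis by (simp add: mult.assoc)
    qed
    ultimately have "2 * inverse z / of_real (1 + 1 / Z) = cnj (2 * z / of_real (1 + Z))"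
      by simp
    moreover have "(1 / Z - 1) / (1 + 1 / Z) = - ((Z - 1) / (1 + Z))"
      using Z by (simp add: divide_simps)
    ultimately show ?thesis
      using False Some by (simp add: sphere_inverse_def W flip: Z_def)
  qed (use Some in \<open>simp add: sphere_inverse_def\<close>)
qed (simp add: sphere_inverse_def)

lemma rho_S_sphere_inverse: "rho_S (sphere_inverse u) (sphere_inverse v) = rho_S u v"
  unfolding dist_stereographic[symmetric] stereographic_sphere_inverse
  by (simp add: dist_Pair_Pair dist_prod_def dist_norm flip: complex_cnj_diff) (simp add: power2_commute)

text \<open>A pole gives the value 0 of \<open>reciprocal\<close>, which inversion sends to
  \<open>None\<close>. Zeros are excluded because their default value 0 would be sent to
  \<open>None\<close> as well.\<close>

lemma sphere_inverse_reciprocal: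
  assumes "meromorphic_C f" "mord f z \<le> 0"
  shows "sphere_inverse (Some (reciprocal f z)) = ext_val f z"
  using assms nonzero_if_mord_eq_0[of f z]
  by (auto simp: sphere_inverse_def reciprocal_def ext_val_def)

section \<open>From equicontinuity of the translates to normality\<close>

text \<open>The translates, viewed on the unit sphere, are bounded and equicontinuous. Arzela-Ascoli
  gives a uniformly Cauchy subsequence on each closed disc of integer radius, and a diagonal
  sequence serves all these discs, hence all compact sets.\<close>

lemma is_normal_function_if_lipschitz:
  assumes "\<eta> > 0" and lip: "\<And>x y. dist x y < \<eta> \<Longrightarrow> rho_S (ext_val f x) (ext_val f y) \<le> L * dist x y"
  shows "is_normal_function f"
  unfolding is_normal_function_def
proof
  fix h :: "nat \<Rightarrow> complex"
  define G where "G x = stereographic (ext_val f x)" for x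
  define P where "P i h \<longleftrightarrow> (\<forall>e>0. \<exists>N. \<forall>n\<ge>N. \<forall>m\<ge>N. \<forall>z\<in>cball 0 (real i). dist (G (z + h n)) (G (z + h m)) < e)"
    for i :: nat and h :: "nat \<Rightarrow> complex"
  have rho: "rho_S (ext_val f x) (ext_val f y) = dist (G x) (G y)" for x y
    by (simp add: G_def dist_stereographic)
  \<comment> \<open>A crude bound: chordal distance at most 2 from the north pole, which has norm
    1.\<close>
  have bounded: "norm (G x) \<le> 3" for x
  proof -
    have "rho_S u None \<le> 2" for u
    proof (cases u)
      case (Some z)
      have "1 \<le> sqrt (1 + (cmod z)\<^sup>2)" by simp
      then show ?thesis using Some frac_le[of 2 2 1 "sqrt (1 + (cmod z)\<^sup>2)"] by simp
    qed simp
    then have "dist (G x) (0, 1) \<le> 2"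
      using dist_stereographic[of _ None] by (simp add: G_def)
    moreover have "norm (0 :: complex, 1 :: real) = 1" by (simp add: norm_Pair)
    ultimately show ?thesis
      using norm_triangle_sub[of "G x" "(0, 1)"] by (simp add: dist_norm)
  qed
  have sub: "\<exists>k. strict_mono k \<and> P i (r \<circ> k)" for i and r :: "nat \<Rightarrow> complex"
  proof -
    have equi: "\<exists>d>0. \<forall>n y. y \<in> cball 0 (real i) \<and> norm (x - y) < d \<longrightarrow> norm (G (x + r n) - G (y + r n)) < e"
      if "e > 0" for x e
    \<comment> \<open>\<open>\<bar>L\<bar> + 1\<close> replaces \<open>L\<close> because
      \<open>L\<close> may be zero or negative.\<close>
    proof (intro exI[of _ "min \<eta> (e / (\<bar>L\<bar> + 1))"] conjI allI impI)
      show "min \<eta> (e / (\<bar>L\<bar> + 1)) > 0" using assms(1) that by simp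
      fix n y assume y: "y \<in> cball 0 (real i) \<and> norm (x - y) < min \<eta> (e / (\<bar>L\<bar> + 1))"
      then have "dist (G (x + r n)) (G (y + r n)) \<le> L * dist (x + r n) (y + r n)"
        using lip[of "x + r n" "y + r n"] by (simp add: rho dist_norm)
      also have "\<dots> \<le> (\<bar>L\<bar> + 1) * norm (x - y)"
        by (simp add: dist_norm mult_right_mono)
      also have "\<dots> < e" using y by (simp add: field_simps)
      finally show "norm (G (x + r n) - G (y + r n)) < e" by (simp add: dist_norm)
    qed
    have "\<exists>g k. strict_mono (k :: nat \<Rightarrow> nat) \<and>
      (\<forall>e>0. \<exists>N. \<forall>n x. n \<ge> N \<and> x \<in> cball 0 (real i) \<longrightarrow> norm (G (x + r (k n)) - g x) < e)"
    proof (rule Arzela_Ascoli[of "cball 0 (real i)" "\<lambda>n x. G (x + r n)" 3])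
      show "compact (cball 0 (real i) :: complex set)" by simp
      show "norm (G (x + r n)) \<le> 3" for n x by (rule bounded)
      show "\<exists>d>0. \<forall>n y. y \<in> cball 0 (real i) \<and> norm (x - y) < d \<longrightarrow> norm (G (x + r n) - G (y + r n)) < e"
        if "e > 0" for x e
        using that by (rule equi)
      fix g and k :: "nat \<Rightarrow> nat"
      assume "strict_mono k"
        and "\<And>e. 0 < e \<Longrightarrow> \<exists>N. \<forall>n x. n \<ge> N \<and> x \<in> cball 0 (real i) \<longrightarrow> norm (G (x + r (k n)) - g x) < e"
      then show ?thesis by (intro exI[of _ g] exI[of _ k]) simp
    qed
    then obtain g and k :: "nat \<Rightarrow> nat" where k: "strict_mono k"
      "\<And>e. 0 < e \<Longrightarrow> \<exists>N. \<forall>n x. n \<ge> N \<and> x \<in> cball 0 (real i) \<longrightarrow> norm (G (x + r (k n)) - g x) < e"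
      by auto
    have "P i (r \<circ> k)"
      unfolding P_def
    proof (intro allI impI)
      fix e :: real assume "e > 0"
      then obtain N where N: "\<And>n x. n \<ge> N \<Longrightarrow> x \<in> cball 0 (real i) \<Longrightarrow> dist (G (x + r (k n))) (g x) < e/2"
        using k(2)[of "e/2"] unfolding dist_norm by (meson half_gt_zero)
      show "\<exists>N. \<forall>n\<ge>N. \<forall>m\<ge>N. \<forall>z\<in>cball 0 (real i). dist (G (z + (r \<circ> k) n)) (G (z + (r \<circ> k) m)) < e"
      proof (intro exI[of _ N] allI impI ballI)
        fix n m z assume "N \<le> n" "N \<le> m" "z \<in> cball (0 :: complex) (real i)"
        then show "dist (G (z + (r \<circ> k) n)) (G (z + (r \<circ> k) m)) < e"
          using dist_triangle_half_l[OF N[of n z] N[of m z]] by simp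
      qed
    qed
    with k(1) show ?thesis by blast
  qed
  \<comment> \<open>A diagonal sequence is a subsequence of each earlier stage only from some index
    on, so the Cauchy property has to survive this weaker form of refinement.\<close>
  have P_P: "P i (r \<circ> k2)"
    if P: "P i (r \<circ> k1)" and k: "\<And>j. N \<le> j \<Longrightarrow> \<exists>j'. j \<le> j' \<and> k2 j = k1 j'"
    for i k1 k2 N and r :: "nat \<Rightarrow> complex"
    unfolding P_def
  proof (intro allI impI)
    fix e :: real assume "e > 0"
    then obtain M where M: "\<forall>n\<ge>M. \<forall>m\<ge>M. \<forall>z\<in>cball 0 (real i). dist (G (z + (r \<circ> k1) n)) (G (z + (r \<circ> k1) m)) < e"
      using P unfolding P_def by blast
    show "\<exists>N. \<forall>n\<ge>N. \<forall>m\<ge>N. \<forall>z\<in>cball 0 (real i). dist (G (z + (r \<circ> k2) n)) (G (z + (r \<circ> k2) m)) < e"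
    proof (intro exI[of _ "max M N"] allI impI ballI)
      fix n m z assume *: "max M N \<le> n" "max M N \<le> m" "z \<in> cball (0 :: complex) (real i)"
      obtain n' m' where "n \<le> n'" "k2 n = k1 n'" "m \<le> m'" "k2 m = k1 m'"
        using k[of n] k[of m] * by auto
      with M * show "dist (G (z + (r \<circ> k2) n)) (G (z + (r \<circ> k2) m)) < e" by simp
    qed
  qed
  have "\<exists>s. strict_mono s \<and> (\<forall>i. P i (h \<circ> s))"
  proof (rule subsequence_diagonalization_lemma[of P h])
    show "\<exists>k. strict_mono k \<and> P i (r \<circ> k)" for i and r :: "nat \<Rightarrow> complex" by (rule sub)
    show "P i (r \<circ> k2)"
      if "P i (r \<circ> k1)" "\<And>j. N \<le> j \<Longrightarrow> \<exists>j'. j \<le> j' \<and> k2 j = k1 j'"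
      for i k1 k2 N and r :: "nat \<Rightarrow> complex"
      using that by (rule P_P)
  qed blast
  then obtain s where s: "strict_mono s" "\<And>i. P i (h \<circ> s)" by blast
  show "\<exists>s :: nat \<Rightarrow> nat. strict_mono s \<and> (\<forall>K. compact K \<longrightarrow> (\<forall>e>0. \<exists>N. \<forall>n\<ge>N. \<forall>m\<ge>N. \<forall>z\<in>K.
      rho_S (ext_val f (z + h (s n))) (ext_val f (z + h (s m))) < e))"
  proof (intro exI[of _ s] conjI s(1) allI impI)
    fix K :: "complex set" and e :: real assume "compact K" "e > 0"
    then obtain b where b: "K \<subseteq> cball 0 b"
      using bounded_subset_ballD[OF compact_imp_bounded, of K 0] ball_subset_cball by blast
    obtain i :: nat where "b \<le> real i" using real_arch_simple by blast
    then have K: "K \<subseteq> cball 0 (real i)" using b subset_cball by blast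
    obtain N where "\<forall>n\<ge>N. \<forall>m\<ge>N. \<forall>z\<in>cball 0 (real i). dist (G (z + (h \<circ> s) n)) (G (z + (h \<circ> s) m)) < e"
      using s(2)[of i] \<open>e > 0\<close> unfolding P_def by blast
    with K show "\<exists>N. \<forall>n\<ge>N. \<forall>m\<ge>N. \<forall>z\<in>K. rho_S (ext_val f (z + h (s n))) (ext_val f (z + h (s m))) < e"
      unfolding rho comp_apply by blast
  qed
qed

section \<open>Uniform Lipschitz bound for \<open>f\<close> or its reciprocal on small discs\<close>

theorem mainTheorem12:
  fixes f :: "complex \<Rightarrow> complex"
  assumes mero: "meromorphic_C f"
    and bnd: "\<forall>\<delta>>0. \<exists>C::real. \<forall>z. z \<notin> Adelta f \<delta> \<longrightarrow> 1 / C \<le> cmod (f z) \<and> cmod (f z) \<le> C"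
    and sep: "\<exists>\<epsilon>>0. \<forall>a b. mord f a > 0 \<longrightarrow> mord f b < 0 \<longrightarrow> \<epsilon> \<le> dist a b"
    and cnt: "\<exists>C0::real. \<forall>c. finite {a. mord f a \<noteq> 0 \<and> dist a c \<le> 1} \<and>
               real (\<Sum>a\<in>{a. mord f a \<noteq> 0 \<and> dist a c \<le> 1}. nat \<bar>mord f a\<bar>) < C0"
  shows "is_normal_function f"
proof -
  define A where "A = {a. mord f a \<noteq> 0}"
  obtain \<epsilon> where \<epsilon>: "\<epsilon> > 0" "\<And>a b. mord f a > 0 \<Longrightarrow> mord f b < 0 \<Longrightarrow> \<epsilon> \<le> dist a b"
    using sep by blast
  obtain C0 :: real where C0: "\<And>c. finite {a\<in>A. dist a c \<le> 1}"
    "\<And>c. real (\<Sum>a\<in>{a\<in>A. dist a c \<le> 1}. nat \<bar>mord f a\<bar>) < C0"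
    using cnt by (auto simp: A_def)
  define N where "N = nat \<lceil>C0\<rceil>"
  \<comment> \<open>Each point of the divisor has multiplicity at least 1, so the count with
    multiplicity dominates the number of distinct points.\<close>
  have card: "card {a\<in>A. dist a c \<le> 1} \<le> N" for c
  proof -
    have "card {a\<in>A. dist a c \<le> 1} = (\<Sum>a\<in>{a\<in>A. dist a c \<le> 1}. 1)" by simp
    also have "\<dots> \<le> (\<Sum>a\<in>{a\<in>A. dist a c \<le> 1}. nat \<bar>mord f a\<bar>)"
      by (intro sum_mono) (auto simp: A_def)
    finally show ?thesis using C0(2)[of c] unfolding N_def by linarith
  qed
  \<comment> \<open>The bound 1/2 is what the circle argument asks for. Two points of an open disc
    of radius \<open>e\<close> are less than \<open>2 * e \<le> \<epsilon>\<close> apart, so it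
    cannot contain both a zero and a pole.\<close>
  define e where "e = min (1/2) (\<epsilon>/2)"
  have e: "0 < e" "e \<le> 1/2" "2 * e \<le> \<epsilon>" using \<epsilon>(1) by (auto simp: e_def)
  define \<delta> where "\<delta> = e / (4 * (real N + 1))"
  have "\<delta> > 0" using e by (simp add: \<delta>_def)
  then obtain C where C: "\<And>z. z \<notin> Adelta f \<delta> \<Longrightarrow> 1 / C \<le> cmod (f z) \<and> cmod (f z) \<le> C"
    using bnd by blast
  \<comment> \<open>Far from the divisor the lower bound on \<open>f\<close> becomes an upper bound
    on the reciprocal; \<open>C > 0\<close> follows from \<open>0 < |f z| \<le> C\<close>.\<close>
  have C': "cmod (f z) \<le> C \<and> cmod (reciprocal f z) \<le> C"
    if "\<And>a. a \<in> A \<Longrightarrow> \<delta> \<le> dist a z" for z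
  proof -
    have "z \<notin> Adelta f \<delta>" using that by (fastforce simp: Adelta_def A_def)
    then have *: "1 / C \<le> cmod (f z)" "cmod (f z) \<le> C" using C by auto
    have "mord f z = 0" using that[of z] \<open>\<delta> > 0\<close> by (auto simp: A_def)
    then have nz: "f z \<noteq> 0" using nonzero_if_mord_eq_0 mero by blast
    then have "C > 0" using *(2) by (meson order_less_le_trans zero_less_norm_iff)
    then have "inverse (cmod (f z)) \<le> C" using *(1) nz by (simp add: field_simps)
    with * \<open>mord f z = 0\<close> show ?thesis by (simp add: reciprocal_def norm_inverse)
  qed
  show ?thesis
  proof (rule is_normal_function_if_lipschitz[of "e/4" f "2 * (8 * C / e)"])
    show "e/4 > 0" using e by simp
    fix x y :: complex assume "dist x y < e/4"
    then have xy: "x \<in> ball x (e/4)" "y \<in> ball x (e/4)" using e(1) by auto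
    then have xy': "x \<in> ball x e" "y \<in> ball x e" using e(1) by auto
    \<comment> \<open>Stated for a general \<open>k\<close>, to serve both \<open>f\<close> and
      \<open>reciprocal f\<close>. The disc is centred at \<open>x\<close> itself, and the factor 2
      comes from \<open>rho_S_Some_le\<close>.\<close>
    have lip: "rho_S (Some (k x)) (Some (k y)) \<le> 2 * (8 * C / e) * dist x y"
      if "meromorphic_C k" "\<And>z. z \<in> ball x e \<Longrightarrow> mord k z \<ge> 0"
        "\<And>z. (\<And>a. a \<in> A \<Longrightarrow> \<delta> \<le> dist a z) \<Longrightarrow> cmod (k z) \<le> C" for k
    proof -
      have "k holomorphic_on ball x e"
        using that(1,2) field_differentiable_if_mord_nonneg
        by (simp add: holomorphic_on_def field_differentiable_at_within)
      then have "cmod (k x - k y) \<le> 8 * C / e * cmod (x - y)"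
        using that(3) by (intro lipschitz_if_bounded_off_sparse_set[OF _ e(1,2) C0(1) card _ xy]) (auto simp: \<delta>_def)
      with rho_S_Some_le[of "k x" "k y"] show ?thesis by (simp add: dist_norm)
    qed
    show "rho_S (ext_val f x) (ext_val f y) \<le> 2 * (8 * C / e) * dist x y"
    proof (cases "\<forall>z\<in>ball x e. mord f z \<ge> 0")
      case True
      then have "ext_val f x = Some (f x)" "ext_val f y = Some (f y)"
        using xy' by (auto simp: ext_val_def not_less)
      with lip[of f] mero True C' show ?thesis by simp
    next
      case False
      then obtain b where b: "b \<in> ball x e" "mord f b < 0" by force
      have np: "mord f z \<le> 0" if "z \<in> ball x e" for z
      proof (rule ccontr)
        assume "\<not> mord f z \<le> 0"
        then have "\<epsilon> \<le> dist z b" using \<epsilon>(2) b by simp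
        then show False using that b e(3) dist_triangle[of z b x] by (simp add: dist_commute)
      qed
      \<comment> \<open>The disc has no zeros, so inversion, an isometry of the sphere, passes to
        the pole-free reciprocal.\<close>
      have "rho_S (ext_val f x) (ext_val f y) = rho_S (Some (reciprocal f x)) (Some (reciprocal f y))"
        using np[OF xy'(1)] np[OF xy'(2)] mero
        by (metis sphere_inverse_reciprocal rho_S_sphere_inverse)
      with lip[of "reciprocal f"] mero np C' show ?thesis
        by (simp add: mord_reciprocal meromorphic_C_reciprocal)
    qed
  qed
qed

end
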